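(* For any $0<\alpha,\beta<1$ and any positive integer $t$, there are positive integers $k,\ell,s$ such that $\mathrm{Z}_{\alpha,\beta}(G^s(\ell,k))-\mathrm{Z}_{\alpha,\beta}(G^s(\ell,k)-u_s)\ge t$.
   Context: All graphs are finite and simple. $G-u$ denotes the graph obtained from $G$ by deleting the vertex $u$. For positive integers $\ell,k$, $G(\ell,k)$ is the graph obtained by identifying a degree-1 vertex of the path $P_{k+1}$ on $k+1$ vertices with the central vertex of the star $K_{1,\ell}$; the identified vertex is called $v$ and its neighbor on the path is called $x$. For a positive integer $s$, $G^s(\ell,k)$ is the graph obtained from $G(\ell,k)$ by adding $s$ new vertices $u_1,\dots,u_s$, each adjacent only to $x$. Let $\alpha,\beta$ be the transmission proportion and the transmission threshold, let $G$ be a graph and $B\subseteq V(G)$ a set of initially filled vertices. The transmission forcing process started from $B$ is defined as follows. Put $B_0=B$, $w_0(v)=1$ for $v\in B$ and $w_0(v)=0$ for $v\in V(G)\setminus B$. For $t\ge 1$, given the set $B_{t-1}$ of vertices filled at time $t-1$ and the weights $w_{t-1}$: for each unfilled vertex $u\in V(G)\setminus B_{t-1}$ let $\mathcal V_{t,u}$ be the set of all $v\in B_{t-1}$ such that $u$ is the only neighbor of $v$ in $V(G)\setminus B_{t-1}$ and $v\notin \mathcal V_{r,u'}$ for every $r<t$ and every $u'$ (each vertex transmits weight at most once); when $v\in\mathcal V_{t,u}$ we say $v$ forces $u$, written $v\to u$. Set $w_t(u)=w_{t-1}(u)+\sum_{v\in\mathcal V_{t,u}}\alpha\, w_{t-1}(v)$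 for $u\in V(G)\setminus B_{t-1}$ and $w_t(u)=w_{t-1}(u)$ for $u\in B_{t-1}$. Then $B_t=B_{t-1}\cup\{u\in V(G)\setminus B_{t-1} : w_t(u)\ge\beta\}$. The set $B$ is an $(\alpha,\beta)$-transmission zero forcing set of $G$ if $B_t=V(G)$ for some $t\ge 0$, and the $(\alpha,\beta)$-transmission zero forcing number $\mathrm{Z}_{\alpha,\beta}(G)$ is the minimum cardinality of such a set. *)

theory Defs
  imports Complex_Main "Graph_Theory.Graph_Theory"
begin

text \<open>
  A finite simple graph is a symmetric loop-free finite digraph without multiple arcs (locale
  \<open>graph\<close>); adjacency is \<open>dominates\<close>, and \<open>G - u\<close> is \<open>pre_digraph.del_vert G u\<close>.

  \<open>transmitters\<close> at time \<open>t\<close> and vertex \<open>u\<close> is the set of all \<open>v\<close> that force \<open>u\<close> at time \<open>t\<close>. The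
  condition on the neighbours of \<open>v\<close> already implies that \<open>u\<close> is an unfilled vertex. A vertex counts
  as having transmitted even if the vertex it forced stayed below the threshold.
\<close>

function (sequential)
      filled :: "real \<Rightarrow> real \<Rightarrow> ('a, 'b) pre_digraph \<Rightarrow> 'a set \<Rightarrow> nat \<Rightarrow> 'a set"
  and weight :: "real \<Rightarrow> real \<Rightarrow> ('a, 'b) pre_digraph \<Rightarrow> 'a set \<Rightarrow> nat \<Rightarrow> 'a \<Rightarrow> real"
  and transmitters :: "real \<Rightarrow> real \<Rightarrow> ('a, 'b) pre_digraph \<Rightarrow> 'a set \<Rightarrow> nat \<Rightarrow> 'a \<Rightarrow> 'a set"
where
  "filled \<alpha> \<beta> G B 0 = B"
| "filled \<alpha> \<beta> G B (Suc t) =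
     filled \<alpha> \<beta> G B t \<union> {u \<in> verts G - filled \<alpha> \<beta> G B t. weight \<alpha> \<beta> G B (Suc t) u \<ge> \<beta>}"
| "weight \<alpha> \<beta> G B 0 u = (if u \<in> B then 1 else 0)"
| "weight \<alpha> \<beta> G B (Suc t) u =
     (if u \<in> verts G - filled \<alpha> \<beta> G B t
      then weight \<alpha> \<beta> G B t u
           + (\<Sum>v\<in>transmitters \<alpha> \<beta> G B (Suc t) u. \<alpha> * weight \<alpha> \<beta> G B t v)
      else weight \<alpha> \<beta> G B t u)"
| "transmitters \<alpha> \<beta> G B 0 u = {}"
| "transmitters \<alpha> \<beta> G B (Suc t) u =
     {v \<in> filled \<alpha> \<beta> G B t.
        {y \<in> verts G - filled \<alpha> \<beta> G B t. v \<rightarrow>\<^bsub>G\<^esub> y} = {u} \<and>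
        (\<forall>r<Suc t. \<forall>u'. v \<notin> transmitters \<alpha> \<beta> G B r u')}"
  by pat_completeness auto
termination
  by (relation "measures
        [case_sum (\<lambda>(_, _, _, _, t). t) (case_sum (\<lambda>(_, _, _, _, t, _). t) (\<lambda>(_, _, _, _, t, _). t)),
         case_sum (\<lambda>_. 2) (case_sum (\<lambda>_. 1) (\<lambda>_. 0))]") auto

definition transmission_forcing_set ::
    "real \<Rightarrow> real \<Rightarrow> ('a, 'b) pre_digraph \<Rightarrow> 'a set \<Rightarrow> bool" where
  "transmission_forcing_set \<alpha> \<beta> G B \<longleftrightarrow> B \<subseteq> verts G \<and> (\<exists>t. filled \<alpha> \<beta> G B t = verts G)"

definition transmission_forcing_number ::
    "real \<Rightarrow> real \<Rightarrow> ('a, 'b) pre_digraph \<Rightarrow> nat" where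
  "transmission_forcing_number \<alpha> \<beta> G = (LEAST n. \<exists>B. transmission_forcing_set \<alpha> \<beta> G B \<and> card B = n)"

lemma transmission_forcing_set_verts: "transmission_forcing_set \<alpha> \<beta> G (verts G)"
  unfolding transmission_forcing_set_def by (auto intro: exI[of _ 0])

lemma transmission_forcing_number_attained:
  "\<exists>B. transmission_forcing_set \<alpha> \<beta> G B \<and> card B = transmission_forcing_number \<alpha> \<beta> G"
  unfolding transmission_forcing_number_def
  by (rule LeastI[where P = "\<lambda>n. \<exists>B. transmission_forcing_set \<alpha> \<beta> G B \<and> card B = n"])
     (use transmission_forcing_set_verts in blast)

lemma transmission_forcing_number_le:
  "transmission_forcing_set \<alpha> \<beta> G B \<Longrightarrow> transmission_forcing_number \<alpha> \<beta> G \<le> card B"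
  unfolding transmission_forcing_number_def by (rule Least_le) blast


text \<open>
  The path \<open>P\<^sub>k\<^sub>+\<^sub>1\<close> has the vertices \<open>Path 0, \<dots>, Path k\<close>. The vertex \<open>v\<close>, at which it is identified
  with the centre of the star, is \<open>Path 0\<close>, and \<open>x\<close> is \<open>Path 1\<close>; hence \<open>k > 0\<close> is needed for \<open>x\<close> to
  exist. \<open>Pendant i\<close> is \<open>u\<^sub>i\<close>.
\<close>

datatype vertex = Leaf nat | Path nat | Pendant nat

definition star_path :: "nat \<Rightarrow> nat \<Rightarrow> vertex pair_pre_digraph" where
  "star_path l k =
     (let E = {(Path 0, Leaf i) | i. i \<in> {1..l}} \<union> {(Path i, Path (Suc i)) | i. i < k}
      in \<lparr> pverts = Leaf ` {1..l} \<union> Path ` {0..k}, parcs = E \<union> E\<inverse> \<rparr>)"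

definition star_path_pendants :: "nat \<Rightarrow> nat \<Rightarrow> nat \<Rightarrow> vertex pair_pre_digraph" where
  "star_path_pendants s l k =
     (let E = {(Path 1, Pendant i) | i. i \<in> {1..s}}
      in \<lparr> pverts = pverts (star_path l k) \<union> Pendant ` {1..s},
           parcs = parcs (star_path l k) \<union> E \<union> E\<inverse> \<rparr>)"

lemma pair_graph_star_path: "pair_graph (star_path l k)"
proof -
  have "finite (parcs (star_path l k))"
    by (rule finite_subset[of _ "pverts (star_path l k) \<times> pverts (star_path l k)"])
       (auto simp: star_path_def Let_def)
  then show ?thesis
    by unfold_locales (auto simp: star_path_def Let_def symmetric_def sym_def)
qed

lemma pair_graph_star_path_pendants:
  assumes "k > 0"
  shows "pair_graph (star_path_pendants s l k)"
proof -
  interpret pair_graph "star_path l k" by (rule pair_graph_star_path)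
  have "Path 1 \<in> pverts (star_path l k)"
    using assms by (auto simp: star_path_def Let_def)
  moreover have "finite {(Path 1, Pendant i) | i. i \<in> {1..s}}"
    by simp
  ultimately show ?thesis
    by unfold_locales
      (auto simp: star_path_pendants_def Let_def symmetric_def sym_def
        dest: in_arcsD1 in_arcsD2 no_loops' arcs_symmetric)
qed

lemma (in graph) graph_del_vert: "graph (del_vert u)"
  using sym_arcs no_loops no_multi_arcs
  by unfold_locales
     (auto simp: del_vert_simps symmetric_conv arc_to_ends_def)

end

theory Submission
  imports Defs
begin

text \<open>
  Choose \<open>s\<close> with \<open>(s - 1) * \<alpha> < \<beta> \<le> s * \<alpha>\<close>. In \<open>G\<^sup>s(l,k) - u\<^sub>s\<close>, start from all leaves and pendants:
  the pendants alone do not fill \<open>x\<close>, so \<open>x\<close> waits for the weight \<open>l * \<alpha>\<^sup>2\<close> coming from the leaves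
  through \<open>v\<close>, and for large \<open>l\<close> this suffices to fill the whole path. In \<open>G\<^sup>s(l,k)\<close>, the vertex \<open>x\<close>
  can transmit into the path only if all \<open>s\<close> pendants are initially filled; but then they fill \<open>x\<close>
  at time 1, with weight at most \<open>s + 2\<close> independently of \<open>l\<close>. Weights decay geometrically along
  initially unfilled stretches of the path, so a forcing set meets every window whose length exceeds
  a bound depending on \<open>\<alpha>\<close>, \<open>\<beta>\<close>, \<open>s\<close> only, and a long path needs arbitrarily many filled vertices.
\<close>

section \<open>The transmission process on an arbitrary graph\<close>

context
  fixes \<alpha> \<beta> :: real and G :: "('a, 'b) pre_digraph" and B :: "'a set"
begin

private abbreviation "F \<equiv> filled \<alpha> \<beta> G B"
private abbreviation "W \<equiv> weight \<alpha> \<beta> G B"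
private abbreviation "T \<equiv> transmitters \<alpha> \<beta> G B"

lemma filled_mono: "m \<le> n \<Longrightarrow> F m \<subseteq> F n"
  by (induction n rule: dec_induct) auto

lemma transmittersD:
  assumes "v \<in> T n u"
  obtains m where "n = Suc m" "v \<in> F m" "u \<in> verts G" "u \<notin> F m" "v \<rightarrow>\<^bsub>G\<^esub> u"
    "\<And>y. y \<in> verts G \<Longrightarrow> v \<rightarrow>\<^bsub>G\<^esub> y \<Longrightarrow> y \<noteq> u \<Longrightarrow> y \<in> F m"
proof (cases n)
  case (Suc m)
  with assms have *: "v \<in> F m" "{y \<in> verts G - F m. v \<rightarrow>\<^bsub>G\<^esub> y} = {u}" by simp_all
  show thesis by (rule that[OF Suc]) (use * in blast)+
qed (use assms in simp)

lemma transmittersI: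
  assumes "v \<in> F m" "u \<in> verts G" "u \<notin> F m" "v \<rightarrow>\<^bsub>G\<^esub> u"
    "\<And>y. y \<in> verts G \<Longrightarrow> v \<rightarrow>\<^bsub>G\<^esub> y \<Longrightarrow> y \<noteq> u \<Longrightarrow> y \<in> F m"
    "\<And>r u'. r \<le> m \<Longrightarrow> v \<notin> T r u'"
  shows "v \<in> T (Suc m) u"
proof -
  have "{y \<in> verts G - F m. v \<rightarrow>\<^bsub>G\<^esub> y} = {u}" using assms by blast
  then show ?thesis using assms by (simp add: less_Suc_eq_le)
qed

text \<open>Earlier transmitters are excluded by definition, and at a fixed time the unfilled
  neighbour is unique. Upper bounds on weights and the count of missing leaves and pendants rest on
  this.\<close>

lemma transmitters_once:
  assumes "v \<in> T n u" "v \<in> T m u'"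
  shows "n = m \<and> u = u'"
proof -
  have *: False if "v \<in> T r w" "v \<in> T q w'" "r < q" for r q w w'
    using that by (cases q) auto
  then have "n = m" using assms by (meson linorder_neqE_nat)
  moreover have "u = u'" using assms \<open>n = m\<close> by (cases n) auto
  ultimately show ?thesis by simp
qed

lemma weight_stable:
  assumes "u \<in> F m" "m \<le> n"
  shows "W n u = W m u"
  using assms(2)
proof (induction n rule: dec_induct)
  case (step n)
  then have "u \<in> F n" using assms(1) filled_mono[of m n] by auto
  then show ?case using step by simp
qed simp

lemma weight_initial: "u \<in> B \<Longrightarrow> W n u = 1"
  using weight_stable[of u 0 n] by simp

lemma filled_weight_ge:
  assumes "u \<in> F n" "u \<notin> B"
  shows "\<beta> \<le> W n u"
  using assms
proof (induction n)
  case (Suc n)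
  show ?case
  proof (cases "u \<in> F n")
    case True
    then show ?thesis using Suc weight_stable[of u n "Suc n"] by simp
  next
    case False
    then show ?thesis using Suc.prems(1) by (simp del: weight.simps)
  qed
qed simp

lemma weight_nonneg: "0 \<le> \<alpha> \<Longrightarrow> 0 \<le> W n u"
  by (induction n arbitrary: u) (auto intro!: add_nonneg_nonneg sum_nonneg)

text \<open>Since a vertex transmits once, the sets of transmitters to \<open>u\<close> at different
  times are disjoint, and each vertex of \<open>S\<close> is charged at most once. This bounds a
  weight without knowing when its contributions arrive.\<close>

lemma weight_le:
  assumes "finite S" "\<And>v. v \<in> S \<Longrightarrow> 0 \<le> c v"
    and "\<And>r v. Suc r \<le> n \<Longrightarrow> v \<in> T (Suc r) u \<Longrightarrow> v \<in> S \<and> \<alpha> * W r v \<le> c v"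
  shows "W n u \<le> (if u \<in> B then 1 else 0) + sum c S"
proof -
  \<comment> \<open>The induction needs the exact set of vertices used so far; it is enlarged to
    \<open>S\<close> only at the end.\<close>
  define U where "U n = (\<Union>r\<in>{..<n}. T (Suc r) u)" for n
  have US: "U m \<subseteq> S" if "m \<le> n" for m
  proof
    fix v
    assume "v \<in> U m"
    then obtain r where "r < m" "v \<in> T (Suc r) u"
      by (auto simp: U_def simp del: transmitters.simps)
    then show "v \<in> S" using assms(3)[of r v] that by simp
  qed
  have "W m u \<le> (if u \<in> B then 1 else 0) + sum c (U m)" if "m \<le> n" for m
    using that
  proof (induction m)
    case 0
    then show ?case by (simp add: U_def)
  next
    case (Suc m)
    have U: "U (Suc m) = U m \<union> T (Suc m) u"
      unfolding U_def by (auto simp: less_Suc_eq simp del: transmitters.simps)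
    have "finite (U (Suc m))" using US[OF Suc.prems] assms(1) by (rule finite_subset)
    then have "finite (U m)" "finite (T (Suc m) u)" unfolding U by simp_all
    moreover have "T (Suc r) u \<inter> T (Suc m) u = {}" if "r < m" for r
      using that transmitters_once[of _ "Suc r" u "Suc m" u] by blast
    then have "U m \<inter> T (Suc m) u = {}" unfolding U_def by blast
    ultimately have sum: "sum c (U (Suc m)) = sum c (U m) + sum c (T (Suc m) u)"
      unfolding U by (simp add: sum.union_disjoint del: transmitters.simps)
    have "(\<Sum>v\<in>T (Suc m) u. \<alpha> * W m v) \<le> sum c (T (Suc m) u)"
      using assms(3) Suc.prems by (intro sum_mono) (auto simp del: transmitters.simps)
    moreover have "0 \<le> sum c (T (Suc m) u)"
      using assms(2) assms(3)[of m] Suc.prems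
      by (intro sum_nonneg) (auto simp del: transmitters.simps)
    ultimately show ?case
      using Suc sum by (auto simp del: transmitters.simps)
  qed
  then have "W n u \<le> (if u \<in> B then 1 else 0) + sum c (U n)" by simp
  also have "sum c (U n) \<le> sum c S"
    using US[of n] assms(1,2) by (intro sum_mono2) auto
  finally show ?thesis by simp
qed

text \<open>Without any transmission the weight of \<open>u\<close> stays 0, below the positive
  threshold.\<close>

lemma forcing_set_transmits:
  assumes "transmission_forcing_set \<alpha> \<beta> G B" "0 < \<beta>" "u \<in> verts G" "u \<notin> B"
  obtains v r where "v \<in> T (Suc r) u"
proof (rule ccontr)
  assume none: "\<not> thesis"
  obtain n where "F n = verts G"
    using assms(1) unfolding transmission_forcing_set_def by blast
  then have "\<beta> \<le> W n u" using assms(3,4) filled_weight_ge by blast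
  moreover have "W n u \<le> (if u \<in> B then 1 else 0) + sum (\<lambda>_. 0) ({} :: 'a set)"
    by (rule weight_le) (use none that in \<open>auto simp del: transmitters.simps\<close>)
  ultimately show False using assms by simp
qed

text \<open>Each vertex of \<open>N\<close> outside \<open>B\<close> must be forced by
  \<open>w\<close>, which forces only once. Applied to the leaves and to the pendants.\<close>

lemma forcing_set_misses_at_most_one_pendant:
  assumes "transmission_forcing_set \<alpha> \<beta> G B" "0 < \<beta>" "finite N" "N \<subseteq> verts G"
    and "\<And>y v. y \<in> N \<Longrightarrow> v \<rightarrow>\<^bsub>G\<^esub> y \<Longrightarrow> v = w"
  shows "card N \<le> card (N \<inter> B) + 1"
proof -
  have "y = y'" if "y \<in> N - B" "y' \<in> N - B" for y y'
  proof -
    have forced: "\<exists>r. w \<in> T (Suc r) z" if "z \<in> N - B" for z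
      using that assms forcing_set_transmits[OF assms(1,2), of z]
      by (metis Diff_iff subsetD transmittersD)
    then show ?thesis using that transmitters_once by metis
  qed
  then have "card (N - B) \<le> 1"
    using assms(3) by (simp add: card_le_Suc0_iff_eq)
  moreover have "card N = card (N \<inter> B) + card (N - B)"
    using assms(3) by (metis card_Int_Diff)
  ultimately show ?thesis by simp
qed

text \<open>When \<open>y\<close> forces \<open>q\<close>, \<open>q\<close> is still unfilled and
  has sent nothing to \<open>y\<close>; all the weight of \<open>y\<close> came from
  \<open>p\<close>, in one transmission. Each initially unfilled path vertex thus costs a factor
  \<alpha>.\<close>

lemma transmission_decay:
  assumes "0 \<le> \<alpha>" "0 \<le> D" "y \<notin> B"
    and nbs: "\<And>v. v \<rightarrow>\<^bsub>G\<^esub> y \<Longrightarrow> v = p \<or> v = q"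
    and D: "\<And>r. p \<in> T (Suc r) y \<Longrightarrow> W r p \<le> D"
    and "y \<in> T (Suc n) q"
  shows "W n y \<le> \<alpha> * D"
proof -
  have "W n y \<le> (if y \<in> B then 1 else 0) + sum (\<lambda>_. \<alpha> * D) {p}"
  proof (rule weight_le)
    fix r v assume r: "Suc r \<le> n" and v: "v \<in> T (Suc r) y"
    have "q \<notin> F n" using assms(6) by (rule transmittersD) simp
    then have "q \<notin> F r" using filled_mono[of r n] r by auto
    then have "v = p" using v nbs by (metis transmittersD nat.inject)
    then show "v \<in> {p} \<and> \<alpha> * W r v \<le> \<alpha> * D"
      using v D assms(1) by (auto intro!: mult_left_mono simp del: transmitters.simps)
  qed (use assms in auto)
  then show ?thesis using assms(3) by simp
qed

end

section \<open>Vertices and adjacency of the two graphs\<close>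

lemma verts_star_path_pendants:
  "verts (with_proj (star_path_pendants s l k)) =
     Leaf ` {1..l} \<union> Path ` {0..k} \<union> Pendant ` {1..s}"
  by (auto simp: star_path_pendants_def star_path_def Let_def)

lemma dominates_star_path_pendants:
  "a \<rightarrow>\<^bsub>with_proj (star_path_pendants s l k)\<^esub> b \<longleftrightarrow>
     (\<exists>i\<in>{1..l}. a = Path 0 \<and> b = Leaf i \<or> a = Leaf i \<and> b = Path 0) \<or>
     (\<exists>i<k. a = Path i \<and> b = Path (Suc i) \<or> a = Path (Suc i) \<and> b = Path i) \<or>
     (\<exists>i\<in>{1..s}. a = Path 1 \<and> b = Pendant i \<or> a = Pendant i \<and> b = Path 1)"
  by (auto simp: star_path_pendants_def star_path_def Let_def)

lemma verts_del_pendant: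
  assumes "s > 0"
  shows "verts (pre_digraph.del_vert (with_proj (star_path_pendants s l k)) (Pendant s)) =
     Leaf ` {1..l} \<union> Path ` {0..k} \<union> Pendant ` {1..<s}"
  unfolding pre_digraph.verts_del_vert verts_star_path_pendants using assms by force

lemma dominates_del_pendant:
  assumes "s > 0"
  shows "a \<rightarrow>\<^bsub>pre_digraph.del_vert (with_proj (star_path_pendants s l k)) (Pendant s)\<^esub> b \<longleftrightarrow>
     (\<exists>i\<in>{1..l}. a = Path 0 \<and> b = Leaf i \<or> a = Leaf i \<and> b = Path 0) \<or>
     (\<exists>i<k. a = Path i \<and> b = Path (Suc i) \<or> a = Path (Suc i) \<and> b = Path i) \<or>
     (\<exists>i\<in>{1..<s}. a = Path 1 \<and> b = Pendant i \<or> a = Pendant i \<and> b = Path 1)"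
proof -
  have "a \<rightarrow>\<^bsub>pre_digraph.del_vert (with_proj (star_path_pendants s l k)) (Pendant s)\<^esub> b \<longleftrightarrow>
     a \<rightarrow>\<^bsub>with_proj (star_path_pendants s l k)\<^esub> b \<and> a \<noteq> Pendant s \<and> b \<noteq> Pendant s"
    by (force simp: pre_digraph.del_vert_def arcs_ends_def arc_to_ends_def)
  then show ?thesis
    unfolding dominates_star_path_pendants using assms by force
qed

section \<open>Upper bound after deletion of a pendant\<close>

text \<open>The vertex \<open>v\<close> collects \<open>l * \<alpha>\<close> from the leaves, and
  each of the \<open>k\<close> path edges costs a factor \<alpha>; the bound on \<open>l\<close>
  lets even \<open>Path k\<close> reach the threshold.\<close>

lemma forcing_number_del_pendant_le:
  assumes "0 < \<alpha>" "\<alpha> < 1" "s > 0" "real (s - 1) * \<alpha> < \<beta>" "\<beta> \<le> real l * \<alpha> ^ (k + 1)"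
  shows "transmission_forcing_number \<alpha> \<beta>
    (pre_digraph.del_vert (with_proj (star_path_pendants s l k)) (Pendant s)) \<le> l + (s - 1)"
proof -
  define H where "H = pre_digraph.del_vert (with_proj (star_path_pendants s l k)) (Pendant s)"
  define B where "B = Leaf ` {1..l} \<union> Pendant ` {1..<s}"
  let ?F = "filled \<alpha> \<beta> H B" and ?W = "weight \<alpha> \<beta> H B" and ?T = "transmitters \<alpha> \<beta> H B"
  note verts = verts_del_pendant[OF assms(3), of l k, folded H_def]
  note dom = dominates_del_pendant[OF assms(3), where l = l and k = k, folded H_def]
  \<comment> \<open>At time \<open>n\<close> exactly the first \<open>n\<close> path vertices are filled: a vertex filled too early would
    freeze at a small weight.\<close>
  have "n \<le> k + 1 \<longrightarrow> ?F n = B \<union> Path ` {..<n} \<and>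
      (\<forall>i. n = Suc i \<longrightarrow> real l * \<alpha> ^ n \<le> ?W n (Path i))" for n
  proof (induction n rule: less_induct)
    case (less n)
    show ?case
    proof (cases n)
      case (Suc m)
      show ?thesis
      proof
        assume nk: "n \<le> k + 1"
        have Fr: "?F r = B \<union> Path ` {..<r}" if "r \<le> m" for r
          using less.IH[of r] that Suc nk by simp
        \<comment> \<open>Up to time \<open>m\<close> the only filled vertices next to
          \<open>Path j\<close> are pendants, and only if \<open>j = 1\<close>; the
          \<open>s - 1\<close> pendants together stay below \<beta>.\<close>
        have low: "?W n (Path j) < \<beta>" if "j \<ge> n" for j
        proof -
          have "?W n (Path j) \<le>
              (if Path j \<in> B then 1 else 0) + sum (\<lambda>_. \<alpha>) (Pendant ` {1..<s})"
          proof (rule weight_le)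
            fix r v assume r: "Suc r \<le> n" and v: "v \<in> ?T (Suc r) (Path j)"
            from v have "v \<in> ?F r" "v \<rightarrow>\<^bsub>H\<^esub> Path j" by (metis transmittersD nat.inject)+
            then have "v \<in> B \<union> Path ` {..<r}" "v \<rightarrow>\<^bsub>H\<^esub> Path j"
              using Fr[of r] r Suc by simp_all
            then have "v \<in> Pendant ` {1..<s}" and "v \<in> B"
              using r Suc that by (auto simp: dom B_def)
            then show "v \<in> Pendant ` {1..<s} \<and> \<alpha> * ?W r v \<le> \<alpha>"
              by (simp add: weight_initial)
          qed (use assms in auto)
          also have "\<dots> = real (s - 1) * \<alpha>"
            by (auto simp: B_def card_image inj_on_def)
          finally show ?thesis using assms by simp
        qed
        have high: "real l * \<alpha> ^ n \<le> ?W n (Path m)"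
        proof -
          have Pm: "Path m \<in> verts H" "Path m \<notin> ?F m"
            using nk Suc Fr[of m] by (auto simp: verts B_def)
          have fin: "finite (?T n (Path m))"
          proof (rule finite_subset)
            show "?T n (Path m) \<subseteq> ?F m" using Suc by auto
            show "finite (?F m)" using Fr[of m] by (simp add: B_def)
          qed
          have nn: "0 \<le> ?W r v" for r v using assms by (intro weight_nonneg) simp
          have W: "?W n (Path m) =
              ?W m (Path m) + (\<Sum>v\<in>?T n (Path m). \<alpha> * ?W m v)"
            using Pm Suc by simp
          \<comment> \<open>At time 1 all leaves transmit to \<open>v\<close>; for each later vertex
            the term of its predecessor is enough.\<close>
          have "real l * \<alpha> ^ n \<le> (\<Sum>v\<in>?T n (Path m). \<alpha> * ?W m v)"
          proof (cases m)
            case 0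
            have "Leaf ` {1..l} \<subseteq> ?T n (Path m)"
            proof clarify
              fix i assume i: "i \<in> {1..l}"
              show "Leaf i \<in> ?T n (Path m)" unfolding Suc
                by (rule transmittersI) (use i 0 Pm in \<open>auto simp: dom B_def\<close>)
            qed
            then have "(\<Sum>v\<in>Leaf ` {1..l}. \<alpha> * ?W m v) \<le> (\<Sum>v\<in>?T n (Path m). \<alpha> * ?W m v)"
              using fin nn assms by (intro sum_mono2) auto
            moreover have "(\<Sum>v\<in>Leaf ` {1..l}. \<alpha> * ?W m v) = (\<Sum>v\<in>Leaf ` {1..l}. \<alpha>)"
              by (intro sum.cong) (auto simp: weight_initial B_def)
            ultimately show ?thesis using Suc 0 by (simp add: card_image inj_on_def)
          next
            case (Suc i)
            have "Path i \<in> ?T (Suc m) (Path m)"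
            proof (rule transmittersI)
              show "y \<in> ?F m" if "Path i \<rightarrow>\<^bsub>H\<^esub> y" "y \<noteq> Path m" for y
                using that Fr[of m] Suc by (auto simp: dom B_def)
              \<comment> \<open>\<open>Path i\<close> is first filled at time
                \<open>m = Suc i\<close>, too late to transmit at a time
                \<open>r \<le> m\<close>.\<close>
              show "Path i \<notin> ?T r u'" if "r \<le> m" for r u'
              proof
                assume "Path i \<in> ?T r u'"
                then obtain q where q: "r = Suc q" "Path i \<in> ?F q" by (rule transmittersD)
                then show False using Fr[of q] that Suc by (auto simp: B_def)
              qed
              show "Path i \<in> ?F m" using Fr[of m] Suc by simp
              have "i < k" using Suc nk \<open>n = Suc m\<close> by simp
              then show "Path i \<rightarrow>\<^bsub>H\<^esub> Path m" unfolding dom Suc by blast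
            qed (use Pm in auto)
            then have "(\<Sum>v\<in>{Path i}. \<alpha> * ?W m v) \<le> (\<Sum>v\<in>?T n (Path m). \<alpha> * ?W m v)"
              using fin nn assms \<open>n = Suc m\<close>
              by (intro sum_mono2) (auto simp del: transmitters.simps)
            moreover have "real l * \<alpha> ^ m \<le> ?W m (Path i)"
              using less.IH[of m] \<open>n = Suc m\<close> nk Suc by simp
            then have "\<alpha> * (real l * \<alpha> ^ m) \<le> \<alpha> * ?W m (Path i)"
              using assms by (intro mult_left_mono) simp_all
            ultimately show ?thesis using \<open>n = Suc m\<close> by (simp add: mult_ac)
          qed
          then show ?thesis using W nn[of m "Path m"] by linarith
        qed
        have "\<alpha> ^ (k + 1) \<le> \<alpha> ^ n"
          using nk assms by (intro power_decreasing) auto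
        then have "real l * \<alpha> ^ (k + 1) \<le> real l * \<alpha> ^ n" by (intro mult_left_mono) auto
        then have thr: "\<beta> \<le> ?W n (Path m)" using high assms by linarith
        have "?F n = ?F m \<union> {u \<in> verts H - ?F m. \<beta> \<le> ?W n u}" using Suc by simp
        moreover have "{u \<in> verts H - ?F m. \<beta> \<le> ?W n u} = {Path m}"
        proof -
          have "u = Path m" if u: "u \<in> verts H - ?F m" "\<beta> \<le> ?W n u" for u
          proof -
            obtain j where j: "u = Path j"
              using u(1) Fr[of m] by (auto simp: verts B_def)
            then have "j \<ge> m" using u(1) Fr[of m] by (cases "j < m") auto
            with j show ?thesis using u(2) low[of j] Suc by (cases "j = m") auto
          qed
          moreover have "Path m \<in> verts H - ?F m"
            using nk Suc Fr[of m] by (auto simp: verts B_def)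
          ultimately show ?thesis using thr by blast
        qed
        ultimately have "?F n = B \<union> Path ` {..<n}"
          using Fr[of m] Suc by (auto simp: lessThan_Suc)
        then show "?F n = B \<union> Path ` {..<n} \<and>
            (\<forall>i. n = Suc i \<longrightarrow> real l * \<alpha> ^ n \<le> ?W n (Path i))"
          using high Suc by simp
      qed
    qed simp
  qed
  then have "?F (k + 1) = B \<union> Path ` {..<k + 1}" by blast
  also have "\<dots> = verts H" by (auto simp: verts B_def)
  finally have "\<exists>t. ?F t = verts H" by blast
  then have "transmission_forcing_set \<alpha> \<beta> H B"
    unfolding transmission_forcing_set_def by (simp add: verts B_def subset_iff)
  then have "transmission_forcing_number \<alpha> \<beta> H \<le> card B"
    by (rule transmission_forcing_number_le)
  also have "card B = l + (s - 1)"
    unfolding B_def by (subst card_Un_disjoint) (auto simp: card_image inj_on_def)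
  finally show ?thesis unfolding H_def .
qed

section \<open>Lower bound for the graph with all pendants\<close>

context
  fixes \<alpha> \<beta> :: real and s l k :: nat and G :: "(vertex, vertex \<times> vertex) pre_digraph"
    and B :: "vertex set"
  assumes \<alpha>: "0 < \<alpha>" "\<alpha> < 1" and \<beta>: "0 < \<beta>" "\<beta> \<le> real s * \<alpha>"
    and G: "G = with_proj (star_path_pendants s l k)"
    and forcing: "transmission_forcing_set \<alpha> \<beta> G B"
begin

private abbreviation "F\<^sub>G \<equiv> filled \<alpha> \<beta> G B"
private abbreviation "W\<^sub>G \<equiv> weight \<alpha> \<beta> G B"
private abbreviation "T\<^sub>G \<equiv> transmitters \<alpha> \<beta> G B"

private lemmas verts = verts_star_path_pendants[of s l k, folded G]
private lemmas dom = dominates_star_path_pendants[where s = s and l = l and k = k, folded G]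

lemma path_neighbour:
  assumes "i \<ge> 1" "v \<rightarrow>\<^bsub>G\<^esub> Path (Suc i)"
  shows "v = Path i \<or> v = Path (Suc (Suc i))"
  using assms by (auto simp: dom)

text \<open>If \<open>x\<close> starts unfilled, the pendants all force it at time 1 and reach the
  threshold by \<open>\<beta> \<le> real s * \<alpha>\<close>. Its weight then freezes before any
  leaf weight can arrive through \<open>v\<close>, which keeps the bound free of
  \<open>l\<close>.\<close>

lemma transmission_from_hub_le:
  assumes tr: "Path 1 \<in> T\<^sub>G (Suc n) (Path 2)"
  shows "W\<^sub>G n (Path 1) \<le> real s + 2"
proof (cases "Path 1 \<in> B")
  case True
  then show ?thesis by (simp add: weight_initial)
next
  case False
  from tr have PF: "Path 1 \<in> F\<^sub>G n" and P2: "Path 2 \<in> verts G"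
    by (metis transmittersD nat.inject)+
  have P1: "Path 1 \<in> verts G" using P2 by (auto simp: verts)
  \<comment> \<open>\<open>x\<close> transmits only once, so a pendant outside \<open>B\<close> would block the path.\<close>
  have pend: "Pendant i \<in> B" if i: "i \<in> {1..s}" for i
  proof (rule ccontr)
    assume "Pendant i \<notin> B"
    moreover have "Pendant i \<in> verts G" using i by (auto simp: verts)
    ultimately obtain v r where v: "v \<in> T\<^sub>G (Suc r) (Pendant i)"
      using forcing_set_transmits[OF forcing \<beta>(1)] by blast
    then have "v \<rightarrow>\<^bsub>G\<^esub> Pendant i" by (rule transmittersD)
    then have "v = Path 1" by (auto simp: dom)
    with v have "Path 1 \<in> T\<^sub>G (Suc r) (Pendant i)" by simp
    from transmitters_once[OF this tr] show False by simp
  qed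
  have "0 < n" using PF False by (cases n) auto
  have Tsub: "Pendant ` {1..s} \<subseteq> T\<^sub>G (Suc 0) (Path 1)"
  proof clarify
    fix i assume i: "i \<in> {1..s}"
    show "Pendant i \<in> T\<^sub>G (Suc 0) (Path 1)"
      by (rule transmittersI) (use i pend[OF i] False P1 in \<open>auto simp: dom\<close>)
  qed
  \<comment> \<open>Source of the constant \<open>s + 2\<close>: the possible neighbours of
    \<open>x\<close>, whose initial weights are at most 1.\<close>
  define S where "S = {Path 0, Path 2} \<union> Pendant ` {1..s}"
  have TS: "v \<in> S" if "v \<in> T\<^sub>G (Suc r) (Path 1)" for r v
  proof -
    from that have "v \<rightarrow>\<^bsub>G\<^esub> Path 1" by (rule transmittersD)
    then show ?thesis by (auto simp: dom S_def numeral_2_eq_2)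
  qed
  have finS: "finite S" by (simp add: S_def)
  then have fin: "finite (T\<^sub>G (Suc 0) (Path 1))"
    using TS by (meson finite_subset subsetI)
  have nn: "0 \<le> W\<^sub>G r v" for r v using \<alpha> by (intro weight_nonneg) simp
  have "real s * \<alpha> = (\<Sum>v\<in>Pendant ` {1..s}. \<alpha>)"
    by (simp add: card_image inj_on_def)
  also have "\<dots> = (\<Sum>v\<in>Pendant ` {1..s}. \<alpha> * W\<^sub>G 0 v)"
    by (intro sum.cong) (auto simp: pend)
  also have "\<dots> \<le> (\<Sum>v\<in>T\<^sub>G (Suc 0) (Path 1). \<alpha> * W\<^sub>G 0 v)"
    using Tsub fin nn \<alpha> by (intro sum_mono2) (auto simp del: transmitters.simps)
  also have "\<dots> = W\<^sub>G (Suc 0) (Path 1)"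
    using False P1 by simp
  finally have "Path 1 \<in> F\<^sub>G (Suc 0)" using P1 \<beta> False by simp
  then have "W\<^sub>G n (Path 1) = W\<^sub>G (Suc 0) (Path 1)"
    using \<open>0 < n\<close> by (intro weight_stable) auto
  also have "\<dots> \<le> (if Path 1 \<in> B then 1 else 0) + sum (\<lambda>_. 1) S"
  proof (rule weight_le)
    fix r v assume "Suc r \<le> Suc 0" "v \<in> T\<^sub>G (Suc r) (Path 1)"
    then show "v \<in> S \<and> \<alpha> * W\<^sub>G r v \<le> 1"
      using TS[of v r] \<alpha> by (simp del: transmitters.simps)
  qed (use finS in auto)
  also have "\<dots> = real (card S)" using False by simp
  also have "card S \<le> card {Path 0, Path 2} + card (Pendant ` {1..s})"
    unfolding S_def by (rule card_Un_le)
  then have "real (card S) \<le> real s + 2"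
    by (simp add: card_image inj_on_def)
  finally show ?thesis .
qed

text \<open>Induction away from \<open>x\<close>: an initially filled vertex has weight 1, and any
  other has at most \<alpha> times the bound for its predecessor.\<close>

lemma path_transmission_le:
  assumes "i \<ge> 1"
  shows "Path i \<in> T\<^sub>G (Suc n) (Path (Suc i)) \<Longrightarrow> W\<^sub>G n (Path i) \<le> real s + 2"
  using assms
proof (induction i arbitrary: n rule: dec_induct)
  case base
  then show ?case using transmission_from_hub_le by (simp add: numeral_2_eq_2)
next
  case (step i)
  show ?case
  proof (cases "Path (Suc i) \<in> B")
    case True
    then show ?thesis by (simp add: weight_initial)
  next
    case False
    have "W\<^sub>G n (Path (Suc i)) \<le> \<alpha> * (real s + 2)"
      by (rule transmission_decay[OF _ _ False path_neighbour step.IH step.prems])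
        (use \<alpha> step in auto)
    also have "\<dots> \<le> real s + 2" using \<alpha> by (intro mult_left_le_one_le) auto
    finally show ?thesis .
  qed
qed

text \<open>Transmission towards \<open>x\<close> is handled by induction from the far end of the
  path, beyond which nothing can supply weight.\<close>

lemma path_back_transmission_le:
  assumes "i \<ge> 1"
  shows "Path (Suc i) \<in> T\<^sub>G (Suc n) (Path i) \<Longrightarrow> W\<^sub>G n (Path (Suc i)) \<le> real s + 2"
  using assms
proof (induction "k - i" arbitrary: i n rule: less_induct)
  case less
  have "Path (Suc i) \<rightarrow>\<^bsub>G\<^esub> Path i" using less.prems(1) by (rule transmittersD)
  then have "i < k" by (auto simp: dom)
  show ?case
  proof (cases "Path (Suc i) \<in> B")
    case True
    then show ?thesis by (simp add: weight_initial)
  next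
    case False
    have "W\<^sub>G n (Path (Suc i)) \<le> \<alpha> * (real s + 2)"
    proof (rule transmission_decay[OF _ _ False _ _ less.prems(1)])
      show "v = Path (Suc (Suc i)) \<or> v = Path i" if "v \<rightarrow>\<^bsub>G\<^esub> Path (Suc i)" for v
        using path_neighbour[OF less.prems(2) that] by blast
      show "W\<^sub>G r (Path (Suc (Suc i))) \<le> real s + 2"
        if "Path (Suc (Suc i)) \<in> T\<^sub>G (Suc r) (Path (Suc i))" for r
        using less.hyps[OF _ that] \<open>i < k\<close> by simp
    qed (use \<alpha> in auto)
    also have "\<dots> \<le> real s + 2" using \<alpha> by (intro mult_left_le_one_le) auto
    finally show ?thesis .
  qed
qed

text \<open>In an unfilled window, weight enters only through the two ends, at most
  \<open>real s + 2\<close> at each, and shrinks by \<alpha> per vertex. The middle vertex, with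
  \<open>m\<close> window vertices on either side, would stay below \<beta>.\<close>

lemma forcing_set_meets_window:
  assumes b: "b \<ge> 1" "Suc b + 2 * m \<le> k" and m: "2 * (real s + 2) * \<alpha> ^ m < \<beta>"
  shows "\<exists>i\<in>{Suc b..Suc b + 2 * m}. Path i \<in> B"
proof (rule ccontr)
  assume "\<not> ?thesis"
  then have notB: "Path i \<notin> B" if "Suc b \<le> i" "i \<le> Suc b + 2 * m" for i
    using that by simp
  define C where "C = real s + 2"
  have C: "0 \<le> C * \<alpha> ^ j" for j using \<alpha> by (simp add: C_def)
  \<comment> \<open>\<open>j\<close> counts the window vertices crossed from the left;
    \<open>Path b\<close> lies just outside.\<close>
  have right: "W\<^sub>G n (Path (b + j)) \<le> C * \<alpha> ^ j"
    if "Path (b + j) \<in> T\<^sub>G (Suc n) (Path (Suc (b + j)))" "j \<le> 2 * m" for j n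
    using that
  proof (induction j arbitrary: n)
    case 0
    then show ?case using path_transmission_le[OF b(1)] by (simp add: C_def del: transmitters.simps)
  next
    case (Suc j)
    have tr: "Path (Suc (b + j)) \<in> T\<^sub>G (Suc n) (Path (Suc (Suc (b + j))))"
      using Suc.prems(1) by (simp del: transmitters.simps)
    have "W\<^sub>G n (Path (Suc (b + j))) \<le> \<alpha> * (C * \<alpha> ^ j)"
      by (rule transmission_decay[OF _ C _ path_neighbour _ tr])
        (use \<alpha> b notB Suc in \<open>auto simp del: transmitters.simps\<close>)
    then show ?case by (simp add: mult_ac)
  qed
  \<comment> \<open>Mirror image: \<open>j\<close> counts window vertices crossed from the right,
    and \<open>j = 0\<close> is the position just beyond the right end.\<close>
  have left: "W\<^sub>G n (Path (Suc i)) \<le> C * \<alpha> ^ j"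
    if "Path (Suc i) \<in> T\<^sub>G (Suc n) (Path i)" "i + j = Suc b + 2 * m" "b \<le> i" for i j n
    using that
  proof (induction j arbitrary: i n)
    case 0
    then show ?case using path_back_transmission_le[of i n] b
      by (simp add: C_def del: transmitters.simps)
  next
    case (Suc j)
    have "W\<^sub>G n (Path (Suc i)) \<le> \<alpha> * (C * \<alpha> ^ j)"
    proof (rule transmission_decay[OF _ C _ _ _ Suc.prems(1)])
      show "v = Path (Suc (Suc i)) \<or> v = Path i" if "v \<rightarrow>\<^bsub>G\<^esub> Path (Suc i)" for v
        using path_neighbour[OF _ that] Suc.prems b by auto
      show "W\<^sub>G r (Path (Suc (Suc i))) \<le> C * \<alpha> ^ j"
        if "Path (Suc (Suc i)) \<in> T\<^sub>G (Suc r) (Path (Suc i))" for r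
        using Suc.IH[OF that] Suc.prems by simp
      show "Path (Suc i) \<notin> B" using notB Suc.prems by simp
    qed (use \<alpha> in auto)
    then show ?case by (simp add: mult_ac)
  qed
  \<comment> \<open>\<open>Path (Suc c)\<close> is the middle of the window.\<close>
  define c where "c = b + m"
  obtain n where n: "F\<^sub>G n = verts G"
    using forcing unfolding transmission_forcing_set_def by blast
  have cB: "Path (Suc c) \<notin> B" using notB by (simp add: c_def)
  have "Path (Suc c) \<in> F\<^sub>G n" unfolding n verts using b by (auto simp: c_def)
  then have "\<beta> \<le> W\<^sub>G n (Path (Suc c))" using cB by (rule filled_weight_ge)
  also have "\<dots> \<le> (if Path (Suc c) \<in> B then 1 else 0)
      + sum (\<lambda>_. C * \<alpha> ^ m) {Path c, Path (Suc (Suc c))}"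
  proof (rule weight_le)
    fix r v assume v: "v \<in> T\<^sub>G (Suc r) (Path (Suc c))"
    then have "v \<rightarrow>\<^bsub>G\<^esub> Path (Suc c)" by (rule transmittersD)
    then have v': "v = Path c \<or> v = Path (Suc (Suc c))"
      using path_neighbour[of c] b by (simp add: c_def)
    then have "W\<^sub>G r v \<le> C * \<alpha> ^ m"
      using v right[of m r] left[of "Suc c" r m]
      by (auto simp: c_def simp del: transmitters.simps)
    then have "\<alpha> * W\<^sub>G r v \<le> \<alpha> * (C * \<alpha> ^ m)" using \<alpha> by (intro mult_left_mono) auto
    also have "\<dots> \<le> C * \<alpha> ^ m" using \<alpha> C by (intro mult_left_le_one_le) auto
    finally show "v \<in> {Path c, Path (Suc (Suc c))} \<and> \<alpha> * W\<^sub>G r v \<le> C * \<alpha> ^ m"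
      using v' by blast
  qed (use C in auto)
  also have "\<dots> = 2 * C * \<alpha> ^ m" using cB by simp
  finally show False using m by (simp add: C_def)
qed

text \<open>\<open>B\<close> misses at most one leaf and one pendant, and \<open>k\<close> is such
  that \<open>Path 2\<close>, ..., \<open>Path k\<close> split into \<open>t + 1\<close> windows of
  \<open>2 * m + 1\<close> vertices. This gives at least \<open>(l - 1) + (s - 1) + (t + 1)\<close>
  vertices.\<close>

lemma card_forcing_set_ge:
  assumes k: "k = 1 + (t + 1) * (2 * m + 1)" and m: "2 * (real s + 2) * \<alpha> ^ m < \<beta>"
  shows "l + s + t \<le> card B + 1"
proof -
  have finB: "finite B"
    using forcing unfolding transmission_forcing_set_def verts
    by (meson finite_Un finite_imageI finite_atLeastAtMost finite_subset)
  have "\<exists>i. 2 + q * (2 * m + 1) \<le> i \<and> i < 2 + (q + 1) * (2 * m + 1) \<and> Path i \<in> B"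
    if "q \<le> t" for q
  proof -
    have "q * (2 * m + 1) \<le> t * (2 * m + 1)" using that by (intro mult_le_mono1)
    then have "\<exists>i\<in>{Suc (1 + q * (2 * m + 1))..Suc (1 + q * (2 * m + 1)) + 2 * m}. Path i \<in> B"
      using k by (intro forcing_set_meets_window m) auto
    then show ?thesis by auto
  qed
  then obtain f where f: "\<And>q. q \<le> t \<Longrightarrow>
      2 + q * (2 * m + 1) \<le> f q \<and> f q < 2 + (q + 1) * (2 * m + 1) \<and> Path (f q) \<in> B"
    by metis
  \<comment> \<open>Division recovers the window from its chosen vertex, so \<open>f\<close> is
    injective.\<close>
  have "(f q - 2) div (2 * m + 1) = q" if "q \<le> t" for q
    using f[OF that] by (intro div_nat_eqI) (auto simp: mult.commute)
  then have "inj_on f {..t}" by (metis atMost_iff inj_onI)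
  then have "card ((\<lambda>q. Path (f q)) ` {..t}) = t + 1"
    by (subst card_image) (auto simp: inj_on_def)
  moreover have "card (Leaf ` {1..l}) \<le> card (Leaf ` {1..l} \<inter> B) + 1"
    by (rule forcing_set_misses_at_most_one_pendant[OF forcing \<beta>(1), where w = "Path 0"])
      (auto simp: verts dom)
  then have "l \<le> card (Leaf ` {1..l} \<inter> B) + 1" by (simp add: card_image inj_on_def)
  moreover have "card (Pendant ` {1..s}) \<le> card (Pendant ` {1..s} \<inter> B) + 1"
    by (rule forcing_set_misses_at_most_one_pendant[OF forcing \<beta>(1), where w = "Path 1"])
      (auto simp: verts dom)
  then have "s \<le> card (Pendant ` {1..s} \<inter> B) + 1" by (simp add: card_image inj_on_def)
  moreover have "card (Leaf ` {1..l} \<inter> B) + card (Pendant ` {1..s} \<inter> B)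
      + card ((\<lambda>q. Path (f q)) ` {..t})
    = card (Leaf ` {1..l} \<inter> B \<union> Pendant ` {1..s} \<inter> B \<union> (\<lambda>q. Path (f q)) ` {..t})"
    by (subst card_Un_disjoint, (auto)[3])+ simp
  moreover have "\<dots> \<le> card B" using f finB by (intro card_mono) auto
  ultimately show ?thesis by linarith
qed

end

theorem theorem5p1p2:
  fixes \<alpha> \<beta> :: real and t :: nat
  assumes "0 < \<alpha>" "\<alpha> < 1" "0 < \<beta>" "\<beta> < 1" "t > 0"
  shows "\<exists>k l s :: nat. k > 0 \<and> l > 0 \<and> s > 0 \<and>
    int (transmission_forcing_number \<alpha> \<beta> (with_proj (star_path_pendants s l k)))
    - int (transmission_forcing_number \<alpha> \<beta>
        (pre_digraph.del_vert (with_proj (star_path_pendants s l k)) (Pendant s))) \<ge> int t"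
proof -
  \<comment> \<open>The least number of pendants that fill \<open>x\<close> on their own; one fewer
    fails.\<close>
  define s where "s = nat \<lceil>\<beta> / \<alpha>\<rceil>"
  have "0 < \<beta> / \<alpha>" using assms by simp
  then have s: "s > 0" "\<beta> / \<alpha> \<le> real s" "real (s - 1) < \<beta> / \<alpha>"
    unfolding s_def by linarith+
  then have s': "\<beta> \<le> real s * \<alpha>" "real (s - 1) * \<alpha> < \<beta>"
    using assms by (simp_all add: field_simps)
  obtain m where "\<alpha> ^ m < \<beta> / (2 * (real s + 2))"
    using real_arch_pow_inv[of "\<beta> / (2 * (real s + 2))" \<alpha>] assms by auto
  then have m: "2 * (real s + 2) * \<alpha> ^ m < \<beta>" by (simp add: field_simps)
  \<comment> \<open>With \<open>t + 1\<close> for \<open>t\<close> the lower bound reads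
    \<open>l + s + t \<le> card B\<close>, against \<open>l + (s - 1)\<close> for the other
    graph.\<close>
  define k where "k = 1 + (t + 1 + 1) * (2 * m + 1)"
  \<comment> \<open>\<open>l\<close> can be chosen last: \<open>m\<close> and \<open>k\<close>
    depend only on \<alpha>, \<beta>, \<open>s\<close> and \<open>t\<close>.\<close>
  obtain l where "\<beta> / \<alpha> ^ (k + 1) < real l" using reals_Archimedean2 by blast
  moreover have "0 < \<beta> / \<alpha> ^ (k + 1)" using assms by simp
  ultimately have l: "l > 0" "\<beta> \<le> real l * \<alpha> ^ (k + 1)"
    using assms by (auto simp: field_simps intro: gr0I)
  let ?G = "with_proj (star_path_pendants s l k)"
  obtain B where B: "transmission_forcing_set \<alpha> \<beta> ?G B"
    "card B = transmission_forcing_number \<alpha> \<beta> ?G"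
    using transmission_forcing_number_attained by blast
  have "l + s + (t + 1) \<le> card B + 1"
    using card_forcing_set_ge[OF assms(1-3) s'(1) refl B(1) k_def m] .
  moreover have "transmission_forcing_number \<alpha> \<beta>
      (pre_digraph.del_vert ?G (Pendant s)) \<le> l + (s - 1)"
    using assms s s' l by (intro forcing_number_del_pendant_le)
  ultimately have "int (transmission_forcing_number \<alpha> \<beta> ?G)
      - int (transmission_forcing_number \<alpha> \<beta> (pre_digraph.del_vert ?G (Pendant s))) \<ge> int t"
    using B(2) s(1) by linarith
  then show ?thesis using s(1) l(1) k_def by (intro exI[of _ k] exI[of _ l] exI[of _ s]) simp
qed

end
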